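(* For every triangle-free graph $H$ on $h$ vertices there exists a constant $\alpha_H>0$ such that the following holds for all $0<\gamma\leq \frac12$ and all positive integers $n$. If $G$ is an $n$-vertex graph containing at least $\gamma n^h$ copies of $H$, then $G$ contains $H[k]$ as a subgraph for some positive integer $k$ with \[ k\geq \alpha_H\,\frac{\log n}{\log(1/\gamma)}. \]
   Context: For a graph $H$ and a positive integer $k$, the blowup $H[k]$ is the graph obtained from $H$ by replacing every vertex by an independent set of size $k$ and every edge by a complete bipartite graph $K_{k,k}$ between the corresponding independent sets. A copy of $H$ in $G$ is a subgraph of $G$ isomorphic to $H$. All logarithms are to base $2$. *)

theory Defs
  imports Complex_Main
begin

definition graph :: "'a set \<Rightarrow> 'a set set \<Rightarrow> bool" where
  "graph V E \<longleftrightarrow> finite V \<and> (\<forall>e\<in>E. card e = 2 \<and> e \<subseteq> V)"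

definition triangle_free :: "'a set set \<Rightarrow> bool" where
  "triangle_free E \<longleftrightarrow> \<not> (\<exists>x y z. {x,y} \<in> E \<and> {y,z} \<in> E \<and> {x,z} \<in> E)"

definition iso_graphs :: "'b set \<Rightarrow> 'b set set \<Rightarrow> 'a set \<Rightarrow> 'a set set \<Rightarrow> bool" where
  "iso_graphs V E V' E' \<longleftrightarrow> (\<exists>f. bij_betw f V V' \<and> E' = (\<lambda>e. f ` e) ` E)"

definition copies :: "'b set \<Rightarrow> 'b set set \<Rightarrow> 'a set \<Rightarrow> 'a set set \<Rightarrow> ('a set \<times> 'a set set) set" where
  "copies VH EH V E = {(V', E'). V' \<subseteq> V \<and> E' \<subseteq> E \<and> iso_graphs VH EH V' E'}"

definition blowup_V :: "'b set \<Rightarrow> nat \<Rightarrow> ('b \<times> nat) set" where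
  "blowup_V VH k = VH \<times> {0..<k}"

definition blowup_E :: "'b set set \<Rightarrow> nat \<Rightarrow> ('b \<times> nat) set set" where
  "blowup_E EH k = {{(u,i),(v,j)} | u v i j. {u,v} \<in> EH \<and> i < k \<and> j < k}"

end

theory Submission
  imports Defs "HOL-Library.FuncSet"
begin

text \<open>
  Vertices \<open>v\<close> of \<open>H\<close> are removed one at a time, each giving a set of \<open>K\<close> vertices of \<open>G\<close>
  that is completely joined to large subsets \<open>V' i\<close> of the candidate sets \<open>V i\<close> of its neighbours \<open>i\<close>,
  while the density \<open>\<gamma>\<close> of homomorphisms only drops to \<open>\<gamma>\<^sup>5\<close>. The subsets come from dependent
  random choice: one samples \<open>K\<close> candidates for \<open>v\<close> together with \<open>K\<close> assignments of
  the non-neighbours of \<open>v\<close>, and keeps the vertices compatible with all of them. A tuple of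
  candidates for the neighbours of \<open>v\<close> with few extensions to \<open>H - v\<close> rarely survives the
  second sample, so on average most surviving tuples have many extensions. As \<open>H\<close> is
  triangle-free, the neighbours of \<open>v\<close> are independent, so the surviving tuples
  form a product set. Each step shrinks the candidate sets by a factor \<open>\<gamma> ^ O(K)\<close>, which is a small
  power of \<open>n\<close> when \<open>K\<close> is a small multiple of \<open>log n / log (1/\<gamma>)\<close>.
\<close>

section \<open>Dependent random choice\<close>

text \<open>Convexity of the \<open>K\<close>-th power: Bernoulli's inequality bounds
  \<open>a x ^ K\<close> below by the tangent at \<open>t\<close>, and in the sum over
  \<open>X\<close> the linear terms are nonnegative because the mean of \<open>a\<close> is at least
  \<open>t\<close>.\<close>

lemma sum_power_ge_card_mult:
  fixes a :: "'x \<Rightarrow> real" and t :: real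
  assumes "\<And>x. x \<in> X \<Longrightarrow> 0 \<le> a x" "0 < t" "t * card X \<le> sum a X"
  shows "t ^ K * card X \<le> (\<Sum>x\<in>X. a x ^ K)"
proof -
  have "t ^ K * (1 + real K * (a x / t - 1)) \<le> a x ^ K" if "x \<in> X" for x
  proof -
    have "1 + real K * (a x / t - 1) \<le> (1 + (a x / t - 1)) ^ K"
      using assms(1)[OF that] assms(2) by (intro Bernoulli_inequality) simp
    then show ?thesis
      using assms(2) by (simp add: power_divide field_simps)
  qed
  then have "(\<Sum>x\<in>X. t ^ K * (1 + real K * (a x / t - 1))) \<le> (\<Sum>x\<in>X. a x ^ K)"
    by (rule sum_mono)
  moreover have "(\<Sum>x\<in>X. t ^ K * (1 + real K * (a x / t - 1))) =
      t ^ K * (card X + real K * (sum a X / t - card X))"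
    by (simp add: sum_distrib_left [symmetric] sum.distrib sum_subtractf sum_divide_distrib)
  moreover have "t ^ K * card X \<le> t ^ K * (card X + real K * (sum a X / t - card X))"
  proof (intro mult_left_mono)
    have "card X \<le> sum a X / t"
      using assms(2,3) by (simp add: field_simps)
    then have "0 \<le> real K * (sum a X / t - card X)"
      by simp
    then show "real (card X) \<le> card X + real K * (sum a X / t - card X)"
      by linarith
  qed (use assms(2) in simp)
  ultimately show ?thesis by linarith
qed

lemma card_distinct_lists_ge:
  assumes "finite C" "K > 0"
  shows "(card C - K) ^ K \<le> card {xs. length xs = K \<and> distinct xs \<and> set xs \<subseteq> C}"
proof (cases "K \<le> card C")
  case True
  have "(\<Prod>i\<in>{card C - K + 1..card C}. card C - K) \<le> \<Prod>{card C - K + 1..card C}"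
    by (rule prod_mono) auto
  with True show ?thesis
    using assms by (simp add: card_lists_distinct_length_eq)
\<comment> \<open>Truncated subtraction makes the left side \<open>0 ^ K\<close> here, which
  vanishes since \<open>K > 0\<close>.\<close>
qed (use assms in \<open>simp add: power_0_left\<close>)

text \<open>In the application \<open>X\<close> consists of the tuples for the neighbours of
  \<open>v\<close>, \<open>A\<close> of the candidates for \<open>v\<close> and \<open>Y\<close> of
  the assignments of the non-neighbours. A tuple \<open>x\<close> survives a sample of
  \<open>K\<close> elements from each of \<open>A\<close> and \<open>Y\<close> with weight about
  \<open>(card (C x) * card (W x)) ^ K\<close>. By convexity this is large on average, while a tuple
  with small \<open>W x\<close> has exponentially smaller weight, so some sample keeps many tuples,
  most of them with large \<open>W x\<close>.\<close>

lemma dense_sampled_subset: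
  fixes C :: "'x \<Rightarrow> 's set" and W :: "'x \<Rightarrow> 'y set" and \<gamma> :: real
  assumes fin: "finite X" "finite A" "finite Y" and ne: "X \<noteq> {}" "A \<noteq> {}" "Y \<noteq> {}"
    and sub: "\<And>x. x \<in> X \<Longrightarrow> C x \<subseteq> A" "\<And>x. x \<in> X \<Longrightarrow> W x \<subseteq> Y"
    and g: "0 < \<gamma>" "\<gamma> \<le> 1/2" and K: "K > 0" "real K \<le> \<gamma> / 2 * card A"
    and dens: "\<gamma> * (real (card A) * card Y * card X) \<le> (\<Sum>x\<in>X. real (card (C x) * card (W x)))"
  obtains S U where "S \<subseteq> A" "card S = K" "U \<subseteq> Y"
    "\<gamma> ^ (4 * K) * card X \<le> real (card {x\<in>X. S \<subseteq> C x \<and> U \<subseteq> W x})"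
    "\<gamma> / 16 * (real (card Y) * card {x\<in>X. S \<subseteq> C x \<and> U \<subseteq> W x}) \<le>
      (\<Sum>x\<in>{x\<in>X. S \<subseteq> C x \<and> U \<subseteq> W x}. real (card (W x)))"
proof -
  define N M where "N = real (card A)" and "M = real (card Y)"
  have NM: "N > 0" "M > 0" and X0: "real (card X) > 0"
    using fin ne by (auto simp: N_def M_def card_gt_0_iff)
  \<comment> \<open>Samples from \<open>A\<close> have distinct entries, so that \<open>S\<close>
    has exactly \<open>K\<close> elements; samples from \<open>Y\<close> may repeat, as the size of
    \<open>U\<close> does not matter.\<close>
  define D where "D B = {xs. length xs = K \<and> distinct xs \<and> set xs \<subseteq> B}" for B :: "'s set"
  define L where "L B = {ys. set ys \<subseteq> B \<and> length ys = K}" for B :: "'y set"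
  define Z where "Z S U = {x\<in>X. S \<subseteq> C x \<and> U \<subseteq> W x}" for S U
  define good where "good x \<longleftrightarrow> \<gamma> / 8 * M \<le> card (W x)" for x
  \<comment> \<open>Good survivors minus bad ones: a single lower bound on the sum of
    \<open>f\<close> shows both that many tuples survive and that at least half of them are
    good.\<close>
  define f where "f x = (if good x then 1 else - 1 :: real)" for x
  have finC: "finite (C x)" "finite (W x)" if "x \<in> X" for x
    using sub[OF that] fin finite_subset by blast+
  have finD: "finite (D A)"
    by (rule finite_subset[OF _ finite_lists_length_eq[OF fin(2), of K]]) (auto simp: D_def)
  have finL: "finite (L Y)"
    unfolding L_def by (rule finite_lists_length_eq[OF fin(3)])
  have cardL: "real (card (L (W x))) = card (W x) ^ K" if "x \<in> X" for x
    unfolding L_def using finC[OF that] by (simp add: card_lists_length_eq)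
  have cardDA: "real (card (D B)) \<le> N ^ K" if "B \<subseteq> A" for B
  proof -
    have "card (D B) \<le> card {xs. set xs \<subseteq> A \<and> length xs = K}"
      using that by (intro card_mono finite_lists_length_eq fin) (auto simp: D_def)
    also have "\<dots> = card A ^ K"
      by (rule card_lists_length_eq[OF fin(2)])
    finally show ?thesis
      unfolding N_def by (metis of_nat_le_iff of_nat_power)
  qed
  have cardLY: "real (card (L Y)) = M ^ K"
    unfolding L_def M_def using fin by (simp add: card_lists_length_eq)
  have Z_sub: "Z S U \<subseteq> X" for S U by (auto simp: Z_def)
  have finZ: "finite (Z S U)" for S U using Z_sub fin(1) finite_subset by blast

  have dbl: "(\<Sum>p\<in>D A \<times> L Y. \<Sum>x\<in>Z (set (fst p)) (set (snd p)). f x) =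
      (\<Sum>x\<in>X. f x * (real (card (D (C x))) * card (L (W x))))"
  proof -
    have "(\<Sum>p\<in>D A \<times> L Y. \<Sum>x\<in>Z (set (fst p)) (set (snd p)). f x) =
        (\<Sum>p\<in>D A \<times> L Y. \<Sum>x | x \<in> X \<and> (set (fst p) \<subseteq> C x \<and> set (snd p) \<subseteq> W x). f x)"
      by (simp add: Z_def)
    also have "\<dots> = (\<Sum>x\<in>X. \<Sum>p | p \<in> D A \<times> L Y \<and> (set (fst p) \<subseteq> C x \<and> set (snd p) \<subseteq> W x). f x)"
      by (rule sum.swap_restrict) (use finD finL fin in auto)
    also have "\<dots> = (\<Sum>x\<in>X. f x * (real (card (D (C x))) * card (L (W x))))"
    proof (rule sum.cong[OF refl])
      fix x assume x: "x \<in> X"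
      have "{p. p \<in> D A \<times> L Y \<and> (set (fst p) \<subseteq> C x \<and> set (snd p) \<subseteq> W x)} = D (C x) \<times> L (W x)"
        using sub[OF x] by (auto simp: D_def L_def)
      then show "(\<Sum>p | p \<in> D A \<times> L Y \<and> (set (fst p) \<subseteq> C x \<and> set (snd p) \<subseteq> W x). f x) =
          f x * (real (card (D (C x))) * card (L (W x)))"
        by (simp add: card_cartesian_product)
    qed
    finally show ?thesis .
  qed

  have total: "(\<gamma> / 2 * N * M) ^ K * card X \<le> (\<Sum>x\<in>X. real (card (D (C x))) * card (L (W x)))"
  proof -
    \<comment> \<open>Passing from \<open>card (C x)\<close> to the truncated
      \<open>card (C x) - K\<close> costs at most \<open>K * M\<close> for each \<open>x\<close>. By
      \<open>K \<le> \<gamma> / 2 * card A\<close> this uses up at most half of the density.\<close>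
    define a where "a x = real (card (C x) - K) * card (W x)" for x
    have "(\<Sum>x\<in>X. real (card (C x) * card (W x)) - K * M) \<le> sum a X"
    proof (rule sum_mono)
      fix x assume x: "x \<in> X"
      have le: "real (card (W x)) \<le> M"
        unfolding M_def using card_mono[OF fin(3) sub(2)[OF x]] by simp
      have "real (card (C x) * card (W x)) - K * M \<le> (real (card (C x)) - K) * card (W x)"
        using mult_left_mono[OF le, of K] by (simp add: algebra_simps)
      also have "\<dots> \<le> a x"
        unfolding a_def by (intro mult_right_mono) auto
      finally show "real (card (C x) * card (W x)) - K * M \<le> a x" .
    qed
    moreover have "real K * M * card X \<le> \<gamma> / 2 * N * M * card X"
      using K(2) NM by (intro mult_right_mono) (auto simp: N_def)
    ultimately have "\<gamma> / 2 * N * M * card X \<le> sum a X"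
      using dens by (simp add: sum_subtractf N_def M_def algebra_simps)
    then have "(\<gamma> / 2 * N * M) ^ K * card X \<le> (\<Sum>x\<in>X. a x ^ K)"
      using g NM by (intro sum_power_ge_card_mult) (auto simp: a_def)
    also have "\<dots> \<le> (\<Sum>x\<in>X. real (card (D (C x))) * card (L (W x)))"
    proof (rule sum_mono)
      fix x assume x: "x \<in> X"
      have "real ((card (C x) - K) ^ K) \<le> real (card (D (C x)))"
        unfolding D_def using card_distinct_lists_ge[OF finC(1)[OF x] K(1)] by (rule of_nat_mono)
      then show "a x ^ K \<le> real (card (D (C x))) * card (L (W x))"
        using x by (simp add: a_def power_mult_distrib cardL mult_right_mono)
    qed
    finally show ?thesis .
  qed

  have bad: "real (card (D (C x))) * card (L (W x)) \<le> (\<gamma> / 8 * N * M) ^ K"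
    if "x \<in> X" "\<not> good x" for x
  proof -
    have "real (card (W x)) \<le> \<gamma> / 8 * M"
      using that(2) by (simp add: good_def)
    then have "real (card (L (W x))) \<le> (\<gamma> / 8 * M) ^ K"
      unfolding cardL[OF that(1)] of_nat_power by (intro power_mono) auto
    then have "real (card (D (C x))) * card (L (W x)) \<le> N ^ K * (\<gamma> / 8 * M) ^ K"
      using sub[OF that(1)] NM cardDA by (intro mult_mono) auto
    then show ?thesis by (simp add: power_mult_distrib power_divide mult_ac)
  qed

  define \<epsilon> where "\<epsilon> = \<gamma> ^ (4 * K) * card X"
  have eps0: "\<epsilon> > 0" using g X0 by (simp add: \<epsilon>_def)
  \<comment> \<open>The bad term is at most half of \<open>(\<gamma> / 2) ^ K\<close>, and the other
    half exceeds \<open>\<gamma> ^ (4 * K)\<close> because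
    \<open>\<gamma> * \<gamma> * \<gamma> < 1/4\<close>.\<close>
  have num: "\<gamma> ^ (4 * K) < (\<gamma> / 2) ^ K - 2 * (\<gamma> / 8) ^ K"
  proof -
    have "(\<gamma> / 8) ^ K = (1/4) ^ K * (\<gamma> / 2) ^ K"
      by (simp add: power_mult_distrib [symmetric])
    moreover have "(1/4::real) ^ K \<le> (1/4) ^ 1"
      using K by (intro power_decreasing) auto
    ultimately have "2 * (\<gamma> / 8) ^ K \<le> (1/2) * (\<gamma> / 2) ^ K"
      using g mult_right_mono[of "(1/4::real) ^ K" "1/4" "(\<gamma> / 2) ^ K"] by simp
    moreover have "\<gamma> ^ (4 * K) < (1/2) * (\<gamma> / 2) ^ K"
    proof -
      have "\<gamma> * \<gamma> \<le> 1/2 * (1/2)" using g by (intro mult_mono) auto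
      then have "\<gamma> * \<gamma> * \<gamma> \<le> 1/4 * \<gamma>" using g by (intro mult_right_mono) auto
      then have "\<gamma> * \<gamma> * \<gamma> < 1/4" using g by linarith
      then have "(\<gamma> * \<gamma> * \<gamma>) ^ K < (1/4) ^ K"
        using K g by (intro power_strict_mono) auto
      moreover have "\<gamma> ^ (4 * K) = (\<gamma> * \<gamma> * \<gamma>) ^ K * \<gamma> ^ K"
        by (simp add: power_mult power4_eq_xxxx flip: power_mult_distrib)
      ultimately have "\<gamma> ^ (4 * K) < (1/4) ^ K * \<gamma> ^ K"
        using g by simp
      also have "\<dots> = (1/2) ^ K * (\<gamma> / 2) ^ K"
        by (simp add: power_mult_distrib [symmetric])
      also have "\<dots> \<le> (1/2) ^ 1 * (\<gamma> / 2) ^ K"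
        using K g by (intro mult_right_mono power_decreasing) auto
      finally show ?thesis by simp
    qed
    ultimately show ?thesis by linarith
  qed
  have "\<exists>p\<in>D A \<times> L Y. \<epsilon> \<le> (\<Sum>x\<in>Z (set (fst p)) (set (snd p)). f x)"
  proof (rule ccontr)
    assume "\<not> ?thesis"
    then have "(\<Sum>p\<in>D A \<times> L Y. \<Sum>x\<in>Z (set (fst p)) (set (snd p)). f x) \<le> (\<Sum>p\<in>D A \<times> L Y. \<epsilon>)"
      by (intro sum_mono) force
    also have "\<dots> = real (card (D A)) * card (L Y) * \<epsilon>"
      by (simp add: card_cartesian_product)
    also have "\<dots> \<le> N ^ K * M ^ K * \<epsilon>"
      unfolding cardLY using cardDA[of A] eps0 NM by (intro mult_right_mono) auto
    also have "\<dots> = \<gamma> ^ (4 * K) * ((N * M) ^ K * card X)"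
      by (simp add: \<epsilon>_def power_mult_distrib)
    also have "\<dots> < ((\<gamma> / 2) ^ K - 2 * (\<gamma> / 8) ^ K) * ((N * M) ^ K * card X)"
      using num NM X0 by (intro mult_strict_right_mono) auto
    also have "\<dots> = (\<gamma> / 2 * N * M) ^ K * card X - (\<Sum>x\<in>X. 2 * (\<gamma> / 8 * N * M) ^ K)"
    proof -
      have *: "(t * N * M) ^ K = t ^ K * (N * M) ^ K" for t
        by (metis mult.assoc power_mult_distrib)
      show ?thesis unfolding * sum_constant by algebra
    qed
    also have "\<dots> \<le> (\<Sum>x\<in>X. real (card (D (C x))) * card (L (W x)) - 2 * (\<gamma> / 8 * N * M) ^ K)"
      unfolding sum_subtractf using total by simp
    \<comment> \<open>A bad tuple is counted with weight 1 in \<open>total\<close> and with weight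
      -1 here, hence the factor 2 on its bound.\<close>
    also have "\<dots> \<le> (\<Sum>x\<in>X. f x * (real (card (D (C x))) * card (L (W x))))"
    proof (rule sum_mono)
      fix x assume x: "x \<in> X"
      have "0 \<le> (\<gamma> / 8 * N * M) ^ K" using g NM by simp
      then show "real (card (D (C x))) * card (L (W x)) - 2 * (\<gamma> / 8 * N * M) ^ K
          \<le> f x * (real (card (D (C x))) * card (L (W x)))"
        using bad[OF x] by (auto simp: f_def)
    qed
    finally show False using dbl by simp
  qed
  then obtain s u where su: "s \<in> D A" "u \<in> L Y" "\<epsilon> \<le> sum f (Z (set s) (set u))" by auto
  let ?Z = "Z (set s) (set u)"
  have "sum f ?Z \<le> (\<Sum>x\<in>?Z. 1)" by (rule sum_mono) (simp add: f_def)
  then have big: "\<epsilon> \<le> card ?Z" using su(3) by simp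
  \<comment> \<open>\<open>f x + 1\<close> is 2 on good tuples and 0 on bad ones, so each term is at
    most \<open>card (W x)\<close>; this halves \<open>\<gamma> / 8\<close> to
    \<open>\<gamma> / 16\<close>.\<close>
  have "\<gamma> / 16 * M * (sum f ?Z + card ?Z) = (\<Sum>x\<in>?Z. \<gamma> / 16 * M * (f x + 1))"
    unfolding sum_distrib_left [symmetric] by (simp add: sum.distrib)
  also have "\<dots> \<le> (\<Sum>x\<in>?Z. real (card (W x)))"
    by (rule sum_mono) (auto simp: f_def good_def mult.commute)
  finally have "\<gamma> / 16 * M * (sum f ?Z + card ?Z) \<le> (\<Sum>x\<in>?Z. real (card (W x)))" .
  moreover have "\<gamma> / 16 * M * card ?Z \<le> \<gamma> / 16 * M * (sum f ?Z + card ?Z)"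
    using g NM su(3) eps0 by (intro mult_left_mono) auto
  ultimately have "\<gamma> / 16 * (M * card ?Z) \<le> (\<Sum>x\<in>?Z. real (card (W x)))"
    by (simp add: mult.assoc)
  then show ?thesis
    using su big that[of "set s" "set u"]
    by (auto simp: D_def L_def Z_def \<epsilon>_def M_def distinct_card)
qed


section \<open>Complete pairs from many homomorphisms\<close>

definition homs :: "('b \<Rightarrow> 'b \<Rightarrow> bool) \<Rightarrow> ('a \<Rightarrow> 'a \<Rightarrow> bool) \<Rightarrow> 'b set \<Rightarrow> ('b \<Rightarrow> 'a set) \<Rightarrow> ('b \<Rightarrow> 'a) set"
  where "homs R adj I V = {x \<in> PiE I V. \<forall>i\<in>I. \<forall>j\<in>I. R i j \<longrightarrow> adj (x i) (x j)}"

lemma finite_homs: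
  "finite I \<Longrightarrow> (\<And>i. i \<in> I \<Longrightarrow> finite (V i)) \<Longrightarrow> finite (homs R adj I V)"
  unfolding homs_def by (rule finite_subset[OF _ finite_PiE[of I V]]) auto

text \<open>The exponent \<open>2 * 8 ^ card I * K\<close> is made for the induction: removing a
  vertex turns \<gamma> into \<open>\<gamma> ^ 5\<close> and costs a factor
  \<open>\<gamma> ^ (4 * K)\<close> in the set sizes, and
  \<open>5 * 2 * 8 ^ m + 4 \<le> 2 * 8 ^ (m + 1)\<close>.\<close>

lemma complete_sets_of_many_homs:
  fixes R :: "'b \<Rightarrow> 'b \<Rightarrow> bool" and adj :: "'a \<Rightarrow> 'a \<Rightarrow> bool" and \<gamma> :: real
  assumes "finite I"
    and symR: "\<And>i j. R i j \<Longrightarrow> R j i" and symadj: "\<And>a b. adj a b \<Longrightarrow> adj b a"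
    and tf: "\<And>i j l. R i j \<Longrightarrow> R j l \<Longrightarrow> \<not> R i l"
    and "0 < \<gamma>" "\<gamma> \<le> 1/2" and K: "K > 0"
    and "\<And>i. i \<in> I \<Longrightarrow> finite (V i)"
    and "\<And>i. i \<in> I \<Longrightarrow> real K \<le> \<gamma> ^ (2 * 8 ^ card I * K) * card (V i)"
    and "\<gamma> * (\<Prod>i\<in>I. real (card (V i))) \<le> card (homs R adj I V)"
  shows "\<exists>S. \<forall>i\<in>I. S i \<subseteq> V i \<and> card (S i) = K \<and>
    (\<forall>j\<in>I. R i j \<longrightarrow> (\<forall>a\<in>S i. \<forall>b\<in>S j. adj a b))"
  using assms(1,5,6,8-10)
proof (induction I arbitrary: V \<gamma>)
  case empty
  then show ?case by simp
next
  case (insert v I)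
  note g = insert.prems(1,2) and finV = insert.prems(3)
  define N Q where "N = {i \<in> I. R v i}" and "Q = I - N"
  have I: "I = N \<union> Q" "N \<inter> Q = {}" "v \<notin> N" "v \<notin> Q" and finNQ: "finite N" "finite Q"
    using insert.hyps by (auto simp: N_def Q_def)
  have indep: "\<not> R i j" if "i \<in> N" "j \<in> N" for i j
    using that tf[of v i j] by (auto simp: N_def)
  define Y where "Y = PiE Q V"
  define C where "C x = {s \<in> V v. \<forall>i\<in>N. adj s (x i)}" for x
  define W where "W x = {y \<in> Y. (\<forall>i\<in>N. \<forall>j\<in>Q. R i j \<longrightarrow> adj (x i) (y j)) \<and>
    (\<forall>i\<in>Q. \<forall>j\<in>Q. R i j \<longrightarrow> adj (y i) (y j))}" for x
  have finX: "finite (PiE N V)" and finY: "finite Y"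
    using finNQ finV I(1) by (auto simp: Y_def intro!: finite_PiE)
  have size: "real K \<le> \<gamma> ^ (16 * 8 ^ card I * K) * card (V i)" if "i \<in> insert v I" for i
    using insert.prems(4)[OF that] insert.hyps by simp
  have Vne: "card (V i) > 0" if "i \<in> insert v I" for i
    using size[OF that] K by (cases "card (V i) = 0") auto
  have Vne': "V i \<noteq> {}" if "i \<in> insert v I" for i
    using Vne[OF that] by auto
  have Kle: "real K \<le> \<gamma> / 2 * card (V v)"
  proof -
    have "2 * 1 \<le> (16 * 8 ^ card I) * K"
      using K by (intro mult_le_mono) (auto intro: order_trans[of _ "16 * 1"])
    then have "\<gamma> ^ (16 * 8 ^ card I * K) \<le> \<gamma> ^ 2"
      using g by (intro power_decreasing) auto
    also have "\<dots> \<le> \<gamma> / 2"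
      using g mult_left_mono[of \<gamma> "1/2" \<gamma>] by (simp add: power2_eq_square)
    finally have "\<gamma> ^ (16 * 8 ^ card I * K) * card (V v) \<le> \<gamma> / 2 * card (V v)"
      by (intro mult_right_mono) auto
    then show ?thesis using size[of v] by simp
  qed
  \<comment> \<open>Since \<open>v\<close> has no neighbour in \<open>Q\<close>, the value at
    \<open>v\<close> and the restriction to \<open>Q\<close> constrain each other only through the
    restriction \<open>x\<close> to \<open>N\<close>; hence the product
    \<open>C x \<times> W x\<close>.\<close>
  have "card (homs R adj (insert v I) V) \<le> card (SIGMA x:PiE N V. C x \<times> W x)"
  proof (rule card_inj_on_le)
    let ?F = "\<lambda>z. (restrict z N, z v, restrict z Q)"
    show "inj_on ?F (homs R adj (insert v I) V)"
    proof (rule inj_onI)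
      fix z z' assume z: "z \<in> homs R adj (insert v I) V" "z' \<in> homs R adj (insert v I) V"
        and eq: "?F z = ?F z'"
      have "z i = z' i" if "i \<in> insert v I" for i
      proof -
        have "restrict z N i = restrict z' N i" "restrict z Q i = restrict z' Q i" "z v = z' v"
          using eq by simp_all
        then show ?thesis using that I(1) by (auto split: if_splits)
      qed
      then show "z = z'"
        using z by (intro PiE_ext[of z "insert v I" V z']) (auto simp: homs_def)
    qed
    show "?F ` homs R adj (insert v I) V \<subseteq> (SIGMA x:PiE N V. C x \<times> W x)"
    proof (rule image_subsetI)
      fix z assume z: "z \<in> homs R adj (insert v I) V"
      then have "z i \<in> V i" if "i \<in> insert v I" for i
        using that by (auto simp: homs_def)
      moreover have "adj (z i) (z j)" if "i \<in> insert v I" "j \<in> insert v I" "R i j" for i j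
        using z that by (auto simp: homs_def)
      ultimately show "?F z \<in> (SIGMA x:PiE N V. C x \<times> W x)"
        by (auto simp: C_def W_def Y_def N_def Q_def)
    qed
    show "finite (SIGMA x:PiE N V. C x \<times> W x)"
      using finX finY finV by (intro finite_SigmaI finite_cartesian_product) (auto simp: C_def W_def)
  qed
  also have "\<dots> = (\<Sum>x\<in>PiE N V. card (C x) * card (W x))"
    using finX finY finV by (subst card_SigmaI) (auto simp: C_def W_def card_cartesian_product)
  finally have homs_le: "real (card (homs R adj (insert v I) V)) \<le> (\<Sum>x\<in>PiE N V. real (card (C x) * card (W x)))"
    unfolding of_nat_sum [symmetric] by (rule of_nat_mono)
  have prodI: "(\<Prod>i\<in>I. F i) = (\<Prod>i\<in>N. F i) * (\<Prod>i\<in>Q. F i)" for F :: "'b \<Rightarrow> real"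
    using finNQ I by (simp add: prod.union_disjoint)
  have "\<gamma> * (real (card (V v)) * card Y * card (PiE N V)) \<le> (\<Sum>x\<in>PiE N V. real (card (C x) * card (W x)))"
    using insert.prems(5) homs_le insert.hyps finNQ
    by (simp add: prodI card_PiE Y_def mult_ac)
  then obtain S U where SU: "S \<subseteq> V v" "card S = K" "U \<subseteq> Y"
    and big: "\<gamma> ^ (4 * K) * card (PiE N V) \<le> real (card {x\<in>PiE N V. S \<subseteq> C x \<and> U \<subseteq> W x})"
    and dense: "\<gamma> / 16 * (real (card Y) * card {x\<in>PiE N V. S \<subseteq> C x \<and> U \<subseteq> W x}) \<le>
      (\<Sum>x\<in>{x\<in>PiE N V. S \<subseteq> C x \<and> U \<subseteq> W x}. real (card (W x)))"
    using finX finY finV Vne' I(1) g K Kle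
    by (elim dense_sampled_subset[of "PiE N V" "V v" Y C W \<gamma> K, rotated -1])
      (auto simp: C_def W_def Y_def PiE_eq_empty_iff)
  define Z where "Z = {x\<in>PiE N V. S \<subseteq> C x \<and> U \<subseteq> W x}"
  define V' where "V' i = (if i \<in> N
    then {a \<in> V i. (\<forall>s\<in>S. adj s a) \<and> (\<forall>y\<in>U. \<forall>j\<in>Q. R i j \<longrightarrow> adj a (y j))} else V i)" for i
  have V'_sub: "V' i \<subseteq> V i" for i by (auto simp: V'_def)
  have finV': "finite (V' i)" if "i \<in> I" for i
    using finV[of i] that V'_sub[of i] finite_subset by blast
  have cardX: "real (card (PiE N V)) > 0"
    using Vne finNQ I(1) by (auto simp: card_PiE intro!: prod_pos)
  have "card Z > 0"
    using big g cardX unfolding Z_def [symmetric]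
    by (metis less_le_trans mult_pos_pos of_nat_0_less_iff zero_less_power)
  \<comment> \<open>The edges inside \<open>Q\<close> are a condition in \<open>W x\<close> that
    does not depend on \<open>x\<close>, so one survivor shows that all of \<open>U\<close>
    satisfies it.\<close>
  then obtain x0 where x0: "x0 \<in> Z" by (auto simp: card_gt_0_iff)
  have U: "\<forall>i\<in>Q. \<forall>j\<in>Q. R i j \<longrightarrow> adj (y i) (y j)" if "y \<in> U" for y
    using x0 that by (auto simp: Z_def W_def)
  \<comment> \<open>Given \<open>S\<close> and \<open>U\<close>, each remaining condition on
    \<open>x\<close> concerns a single coordinate in \<open>N\<close>, so the survivors form a
    product.\<close>
  have Z_eq: "Z = PiE N V'"
  proof (intro equalityI subsetI)
    fix x assume x: "x \<in> Z"
    show "x \<in> PiE N V'"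
      using x unfolding Z_def V'_def C_def W_def by (auto simp: PiE_iff subset_iff)
  next
    fix x assume x: "x \<in> PiE N V'"
    then show "x \<in> Z"
      using SU U unfolding Z_def V'_def C_def W_def by (auto simp: PiE_iff subset_iff)
  qed
  \<comment> \<open>If a product of subsets keeps a fraction of the whole product, then each factor
    keeps at least that fraction, as the other factors do not grow.\<close>
  have size': "\<gamma> ^ (4 * K) * card (V i) \<le> card (V' i)" if "i \<in> I" for i
  proof (cases "i \<in> N")
    case True
    define P where "P = (\<Prod>j\<in>N-{i}. real (card (V j)))"
    have P: "P > 0" using Vne I(1) by (auto simp: P_def intro!: prod_pos)
    have "\<gamma> ^ (4 * K) * card (V i) * P = \<gamma> ^ (4 * K) * card (PiE N V)"
      using True finNQ by (simp add: P_def card_PiE prod.remove[of N i])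
    also have "\<dots> \<le> card (PiE N V')"
      using big by (simp add: Z_def [symmetric] Z_eq)
    also have "\<dots> = card (V' i) * (\<Prod>j\<in>N-{i}. real (card (V' j)))"
      using True finNQ by (simp add: card_PiE prod.remove[of N i])
    also have "\<dots> \<le> card (V' i) * P"
      unfolding P_def using finV I(1) V'_sub
      by (intro mult_left_mono prod_mono) (auto intro!: card_mono)
    finally show ?thesis using P by simp
  next
    case False
    have "\<gamma> ^ (4 * K) * card (V i) \<le> 1 * real (card (V i))"
      using g by (intro mult_right_mono power_le_one) auto
    then show ?thesis using False by (simp add: V'_def)
  qed
  \<comment> \<open>The constant 16 is absorbed into a power of \<gamma>, so that the density keeps
    the form needed for the induction.\<close>
  have g16: "\<gamma> ^ 5 \<le> \<gamma> / 16"
  proof -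
    have "\<gamma> ^ 4 \<le> (1/2) ^ 4" using g by (intro power_mono) auto
    then have "\<gamma> * \<gamma> ^ 4 \<le> \<gamma> * (1/16)"
      using g by (intro mult_left_mono) (auto simp: power_divide)
    then show ?thesis by (simp add: eval_nat_numeral)
  qed
  have "\<exists>S'. \<forall>i\<in>I. S' i \<subseteq> V' i \<and> card (S' i) = K \<and>
    (\<forall>j\<in>I. R i j \<longrightarrow> (\<forall>a\<in>S' i. \<forall>b\<in>S' j. adj a b))"
  proof (rule insert.IH[of "\<gamma> ^ 5"])
    show "0 < \<gamma> ^ 5" "\<gamma> ^ 5 \<le> 1/2" using g g16 by auto
    show "finite (V' i)" if "i \<in> I" for i using finV'[OF that] .
    show "real K \<le> (\<gamma> ^ 5) ^ (2 * 8 ^ card I * K) * card (V' i)" if "i \<in> I" for i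
    proof -
      have "10 * 8 ^ card I * K + 4 * K \<le> 16 * 8 ^ card I * K"
      proof -
        have "(1::nat) \<le> 8 ^ card I" by simp
        then have "4 \<le> 6 * (8::nat) ^ card I" by linarith
        then have "4 * K \<le> 6 * 8 ^ card I * K" by (rule mult_le_mono1)
        then show ?thesis by simp
      qed
      then have "\<gamma> ^ (16 * 8 ^ card I * K) \<le> \<gamma> ^ (10 * 8 ^ card I * K + 4 * K)"
        using g by (intro power_decreasing) auto
      then have "\<gamma> ^ (16 * 8 ^ card I * K) * card (V i) \<le>
          \<gamma> ^ (10 * 8 ^ card I * K) * (\<gamma> ^ (4 * K) * card (V i))"
        unfolding power_add mult.assoc [symmetric] by (intro mult_right_mono) auto
      also have "\<dots> \<le> \<gamma> ^ (10 * 8 ^ card I * K) * card (V' i)"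
        using size'[OF that] g by (intro mult_left_mono) auto
      also have "\<gamma> ^ (10 * 8 ^ card I * K) = (\<gamma> ^ 5) ^ (2 * 8 ^ card I * K)"
        unfolding power_mult [symmetric] by (simp add: mult_ac)
      finally show ?thesis using size[of i] that by simp
    qed
    have "(\<Sum>x\<in>Z. card (W x)) = card (SIGMA x:Z. W x)"
      using finX finY by (subst card_SigmaI) (auto simp: Z_def W_def)
    \<comment> \<open>A survivor \<open>x\<close> and some \<open>y\<close> in \<open>W x\<close>
      glue to a homomorphism on \<open>I\<close>: pairs inside \<open>N\<close> carry no edge by
      \<open>indep\<close>, and \<open>W x\<close> handles all others.\<close>
    also have "\<dots> \<le> card (homs R adj I V')"
    proof (rule card_inj_on_le)
      let ?G = "\<lambda>(x, y). \<lambda>i. if i \<in> N then x i else y i"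
      show "inj_on ?G (SIGMA x:Z. W x)"
      proof (rule inj_onI, clarify)
        fix x y x' y'
        assume *: "x \<in> Z" "y \<in> W x" "x' \<in> Z" "y' \<in> W x'"
          and eq: "(\<lambda>i. if i \<in> N then x i else y i) = (\<lambda>i. if i \<in> N then x' i else y' i)"
        have "x i = x' i" if "i \<in> N" for i using fun_cong[OF eq, of i] that by simp
        moreover have "y i = y' i" if "i \<in> Q" for i
          using fun_cong[OF eq, of i] that I(2) by (auto split: if_splits)
        ultimately show "x = x' \<and> y = y'"
          using * PiE_ext[of x N V x'] PiE_ext[of y Q V y'] by (auto simp: Z_def W_def Y_def)
      qed
      show "?G ` (SIGMA x:Z. W x) \<subseteq> homs R adj I V'"
      proof clarify
        fix x y assume *: "x \<in> Z" "y \<in> W x"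
        let ?z = "\<lambda>i. if i \<in> N then x i else y i"
        have x: "x \<in> PiE N V'" and y: "y \<in> PiE Q V"
          using * by (auto simp: Z_eq W_def Y_def)
        have "?z \<in> PiE I V'"
        proof (rule PiE_I)
          show "?z i \<in> V' i" if "i \<in> I" for i
            using that x y I(1) by (auto simp: V'_def dest: PiE_mem)
          show "?z i = undefined" if "i \<notin> I" for i
            using that PiE_arb[OF y, of i] I(1) by auto
        qed
        moreover have "adj (?z i) (?z j)" if ij: "i \<in> I" "j \<in> I" "R i j" for i j
        proof -
          have "i \<in> N \<or> i \<in> Q" "j \<in> N \<or> j \<in> Q" using ij I(1) by auto
          moreover have "i \<notin> N" if "i \<in> Q" for i
            using that by (simp add: Q_def)
          ultimately show ?thesis
            using *(2) ij(3) indep[of i j] symR[of i j] symadj[of "x j" "y i"] by (auto simp: W_def)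
        qed
        ultimately show "?z \<in> homs R adj I V'" by (simp add: homs_def)
      qed
      show "finite (homs R adj I V')"
        by (rule finite_homs[OF insert.hyps(1) finV'])
    qed
    finally have "(\<Sum>x\<in>Z. real (card (W x))) \<le> card (homs R adj I V')"
      unfolding of_nat_sum [symmetric] by (rule of_nat_mono)
    moreover have "(\<Prod>i\<in>I. real (card (V' i))) = real (card Y) * card Z"
    proof -
      have "(\<Prod>i\<in>Q. real (card (V' i))) = card Y"
        using finNQ I(2) by (auto simp: Y_def card_PiE V'_def intro!: prod.cong)
      then show ?thesis using finNQ by (simp add: prodI Z_eq card_PiE)
    qed
    moreover have "\<gamma> ^ 5 * (real (card Y) * card Z) \<le> \<gamma> / 16 * (real (card Y) * card Z)"
      using g16 by (intro mult_right_mono) auto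
    ultimately show "\<gamma> ^ 5 * (\<Prod>i\<in>I. real (card (V' i))) \<le> card (homs R adj I V')"
      using dense by (simp add: Z_def [symmetric])
  qed
  then obtain S' where S': "\<forall>i\<in>I. S' i \<subseteq> V' i \<and> card (S' i) = K \<and>
    (\<forall>j\<in>I. R i j \<longrightarrow> (\<forall>a\<in>S' i. \<forall>b\<in>S' j. adj a b))"
    by (rule exE)
  have S_adj: "adj s b" if "s \<in> S" "j \<in> I" "R v j" "b \<in> S' j" for s j b
  proof -
    have "b \<in> V' j" using S' that by auto
    then show ?thesis using that by (auto simp: V'_def N_def)
  qed
  \<comment> \<open>The degenerate triangle rules out a loop at \<open>v\<close>, so nothing is
    required between elements of \<open>S\<close>.\<close>
  have irrefl: "\<not> R v v" using tf[of v v v] by auto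
  show ?case
  proof (intro exI[of _ "S'(v := S)"] ballI conjI impI)
    fix i assume i: "i \<in> insert v I"
    show "(S'(v := S)) i \<subseteq> V i" "card ((S'(v := S)) i) = K"
      using i S' SU(1,2) V'_sub[of i] by (auto simp: subset_iff)
    fix j a b assume j: "j \<in> insert v I" "R i j" "a \<in> (S'(v := S)) i" "b \<in> (S'(v := S)) j"
    consider "i = v" "j \<in> I" "j \<noteq> v" | "j = v" "i \<in> I" "i \<noteq> v" | "i \<in> I" "j \<in> I" "i \<noteq> v" "j \<noteq> v"
      using i j(1,2) irrefl by auto
    then show "adj a b"
    proof cases
      case 1
      then show ?thesis using j S_adj by simp
    next
      case 2
      then show ?thesis using j symR[of i j] symadj[of b a] S_adj[of b i a] by simp
    next
      case 3
      then show ?thesis using j S' by simp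
    qed
  qed
qed

section \<open>From complete pairs to a blowup\<close>

text \<open>Greedy choice: the sets already chosen block at most \<open>card I * k\<close> elements
  of the next one, leaving \<open>k\<close>.\<close>

lemma disjoint_subsets_of_large_sets:
  assumes "finite I" "\<And>i. i \<in> I \<Longrightarrow> card I * k \<le> card (S i)"
  shows "\<exists>T. (\<forall>i\<in>I. T i \<subseteq> S i \<and> card (T i) = k) \<and> (\<forall>i\<in>I. \<forall>j\<in>I. i \<noteq> j \<longrightarrow> T i \<inter> T j = {})"
  using assms
proof (induction I)
  case empty
  then show ?case by simp
next
  case (insert v I)
  have "card I * k \<le> card (S i)" if "i \<in> I" for i
    using insert.prems[of i] that insert.hyps by simp
  then obtain T where T: "\<forall>i\<in>I. T i \<subseteq> S i \<and> card (T i) = k"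
    "\<forall>i\<in>I. \<forall>j\<in>I. i \<noteq> j \<longrightarrow> T i \<inter> T j = {}"
    using insert.IH by blast
  have "card (\<Union>(T ` I)) \<le> (\<Sum>i\<in>I. card (T i))"
    by (rule card_UN_le[OF insert.hyps(1)])
  then have le: "card (\<Union>(T ` I)) \<le> card I * k" using T(1) by simp
  have "k \<le> card (S v - \<Union>(T ` I))"
  \<comment> \<open>Only for \<open>k > 0\<close> does \<open>card (T i) = k\<close> force
    \<open>T i\<close> to be finite.\<close>
  proof (cases "k = 0")
    case False
    then have "finite (\<Union>(T ` I))"
      using T(1) insert.hyps(1) by (auto intro: card_ge_0_finite)
    then have "card (S v) - card (\<Union>(T ` I)) \<le> card (S v - \<Union>(T ` I))"
      by (rule diff_card_le_card_Diff)
    then show ?thesis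
      using le insert.prems[of v] insert.hyps by simp
  qed simp
  then obtain B where B: "B \<subseteq> S v - \<Union>(T ` I)" "card B = k"
    by (rule obtain_subset_with_card_n)
  show ?case
    by (rule exI[of _ "T(v := B)"]) (use B T insert.hyps in auto)
qed

lemma copies_blowup_nonempty:
  fixes S :: "'b \<Rightarrow> 'a set"
  assumes k: "k > 0"
    and S: "\<And>i. i \<in> VH \<Longrightarrow> S i \<subseteq> V \<and> card (S i) = k"
    and disj: "\<And>i j. i \<in> VH \<Longrightarrow> j \<in> VH \<Longrightarrow> i \<noteq> j \<Longrightarrow> S i \<inter> S j = {}"
    and edge: "\<And>i j a b. {i, j} \<in> EH \<Longrightarrow> a \<in> S i \<Longrightarrow> b \<in> S j \<Longrightarrow> {a, b} \<in> E"
    and EH: "\<And>e. e \<in> EH \<Longrightarrow> e \<subseteq> VH"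
  shows "copies (blowup_V VH k) (blowup_E EH k) V E \<noteq> {}"
proof -
  have "\<exists>b. bij_betw b {0..<k} (S i)" if "i \<in> VH" for i
    using ex_bij_betw_nat_finite[of "S i"] S[OF that] k card_ge_0_finite[of "S i"] by auto
  then obtain b where b: "\<And>i. i \<in> VH \<Longrightarrow> bij_betw (b i) {0..<k} (S i)" by metis
  define f where "f = (\<lambda>(i, m). b i m)"
  have fS: "f (i, m) \<in> S i" if "i \<in> VH" "m < k" for i m
    using b[OF that(1)] that(2) by (auto simp: f_def bij_betw_def)
  have "inj_on f (blowup_V VH k)"
  proof (rule inj_onI, clarify)
    fix i m j l assume *: "(i, m) \<in> blowup_V VH k" "(j, l) \<in> blowup_V VH k" "f (i, m) = f (j, l)"
    then have ij: "i \<in> VH" "j \<in> VH" "m < k" "l < k" by (auto simp: blowup_V_def)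
    have "i = j" using fS[of i m] fS[of j l] ij *(3) disj[of i j] by auto
    moreover have "m = l"
      using b[OF ij(1)] ij *(3) \<open>i = j\<close> by (auto simp: f_def bij_betw_def inj_on_def)
    ultimately show "i = j \<and> m = l" by blast
  qed
  then have "bij_betw f (blowup_V VH k) (f ` blowup_V VH k)" by (rule inj_on_imp_bij_betw)
  moreover have "f ` blowup_V VH k \<subseteq> V"
    using fS S by (fastforce simp: blowup_V_def)
  moreover have "(\<lambda>e. f ` e) ` blowup_E EH k \<subseteq> E"
  proof clarify
    fix e assume "e \<in> blowup_E EH k"
    then obtain u v i j where e: "e = {(u, i), (v, j)}" "{u, v} \<in> EH" "i < k" "j < k"
      by (auto simp: blowup_E_def)
    then show "f ` e \<in> E" using edge[OF e(2)] fS EH[OF e(2)] by simp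
  qed
  ultimately have "(f ` blowup_V VH k, (\<lambda>e. f ` e) ` blowup_E EH k) \<in>
      copies (blowup_V VH k) (blowup_E EH k) V E"
    unfolding copies_def iso_graphs_def by blast
  then show ?thesis by blast
qed

text \<open>Every copy is the image of a homomorphism, namely of the isomorphism onto it, restricted
  to \<open>VH\<close> to be extensional.\<close>

lemma card_copies_le_card_homs:
  assumes "finite VH" "finite V" "\<And>e. e \<in> EH \<Longrightarrow> e \<subseteq> VH"
  shows "card (copies VH EH V E) \<le>
    card (homs (\<lambda>i j. {i, j} \<in> EH) (\<lambda>a b. {a, b} \<in> E) VH (\<lambda>_. V))"
proof (rule surj_card_le)
  show "finite (homs (\<lambda>i j. {i, j} \<in> EH) (\<lambda>a b. {a, b} \<in> E) VH (\<lambda>_. V))"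
    using assms by (intro finite_homs) auto
  show "copies VH EH V E \<subseteq> (\<lambda>f. (f ` VH, (\<lambda>e. f ` e) ` EH)) `
      homs (\<lambda>i j. {i, j} \<in> EH) (\<lambda>a b. {a, b} \<in> E) VH (\<lambda>_. V)"
  proof clarify
    fix V' E' assume "(V', E') \<in> copies VH EH V E"
    then obtain f where f: "V' \<subseteq> V" "E' \<subseteq> E" "bij_betw f VH V'" "E' = (\<lambda>e. f ` e) ` EH"
      by (auto simp: copies_def iso_graphs_def)
    have "restrict f VH ` e = f ` e" if "e \<in> EH" for e
      using assms(3)[OF that] by (intro image_cong) auto
    then have "E' = (\<lambda>e. restrict f VH ` e) ` EH" using f(4) by simp
    moreover have "V' = restrict f VH ` VH" using f(3) by (simp add: bij_betw_def)
    moreover have "restrict f VH \<in> homs (\<lambda>i j. {i, j} \<in> EH) (\<lambda>a b. {a, b} \<in> E) VH (\<lambda>_. V)"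
    proof -
      have "restrict f VH \<in> VH \<rightarrow>\<^sub>E V" using f(1,3) by (auto simp: bij_betw_def)
      moreover have "{f i, f j} \<in> E" if "{i, j} \<in> EH" for i j
      proof -
        have "f ` {i, j} \<in> E'" using that f(4) by blast
        then show ?thesis using f(2) by auto
      qed
      ultimately show ?thesis by (auto simp: homs_def)
    qed
    ultimately show "(V', E') \<in> (\<lambda>f. (f ` VH, (\<lambda>e. f ` e) ` EH)) `
      homs (\<lambda>i j. {i, j} \<in> EH) (\<lambda>a b. {a, b} \<in> E) VH (\<lambda>_. V)" by blast
  qed
qed

section \<open>Choice of the constants\<close>

lemma log2_le_sqrt:
  fixes x :: real
  assumes "x \<ge> 1"
  shows "log 2 x \<le> 4 * sqrt x"
proof -
  have "ln (sqrt x) \<le> sqrt x" using assms by (intro ln_bound) auto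
  then have "ln x \<le> 2 * sqrt x" using assms by (simp add: ln_sqrt)
  moreover have "ln 2 \<ge> (1/2::real)" using ln_one_minus_pos_lower_bound[of "1/2"] ln_le_minus_one[of "1/2::real"] by (simp add: ln_div)
  ultimately have "ln x / ln 2 \<le> (2 * sqrt x) / (1/2)"
    using assms by (intro frac_le) auto
  then show ?thesis by (simp add: log_def)
qed

theorem theorem1p2:
  fixes h :: nat and EH :: "nat set set"
  assumes "graph {0..<h} EH" and "triangle_free EH"
  shows "\<exists>\<alpha>::real. \<alpha> > 0 \<and>
    (\<forall>\<gamma>::real. 0 < \<gamma> \<and> \<gamma> \<le> 1/2 \<longrightarrow>
      (\<forall>n::nat. n > 0 \<longrightarrow>
        (\<forall>E :: nat set set. graph {0..<n} E \<and>
            real (card (copies {0..<h} EH {0..<n} E)) \<ge> \<gamma> * real n ^ h \<longrightarrow>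
          (\<exists>k::nat. k > 0 \<and> copies (blowup_V {0..<h} k) (blowup_E EH k) {0..<n} E \<noteq> {} \<and>
             real k \<ge> \<alpha> * log 2 (real n) / log 2 (1/\<gamma>)))))"
proof -
  \<comment> \<open>\<open>A * k\<close> is the exponent of \<gamma> that the embedding lemma asks
    for with \<open>K = (h + 1) * k\<close>. In the 4 of \<alpha>, one factor 2 pays for rounding
    \<open>X\<close> up to \<open>k\<close> and the other for keeping \<open>sqrt n\<close> of the
    \<open>n\<close> vertices.\<close>
  define A where "A = 2 * 8 ^ h * (h + 1)"
  define \<alpha> where "\<alpha> = 1 / (4 * real A)"
  have A: "A \<ge> 2 * (h + 1)" unfolding A_def by (intro mult_le_mono) auto
  have A0: "real A > 0" using A by (cases "A = 0") auto
  have \<alpha>: "\<alpha> > 0" using A0 by (simp add: \<alpha>_def)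
  have EH: "e \<subseteq> {0..<h}" if "e \<in> EH" for e using assms(1) that by (simp add: graph_def)
  have "\<exists>k>0. copies (blowup_V {0..<h} k) (blowup_E EH k) {0..<n} E \<noteq> {} \<and>
      real k \<ge> \<alpha> * log 2 (real n) / log 2 (1/\<gamma>)"
    if g: "0 < \<gamma>" "\<gamma> \<le> 1/2" and n: "n > 0"
      and dens: "real (card (copies {0..<h} EH {0..<n} E)) \<ge> \<gamma> * real n ^ h"
    for \<gamma> :: real and n :: nat and E :: "nat set set"
  proof -
    define X where "X = \<alpha> * log 2 (real n) / log 2 (1/\<gamma>)"
    have lg: "log 2 (1/\<gamma>) \<ge> 1"
      using g by (subst le_log_iff) (auto simp: field_simps)
    show ?thesis
    proof (cases "X \<le> 1")
      \<comment> \<open>Here \<open>k = 1\<close> suffices: the blowup is \<open>H\<close> itself,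
        and the density gives a copy.\<close>
      case True
      have "\<gamma> * real n ^ h > 0" using g n by simp
      then have "card (copies {0..<h} EH {0..<n} E) \<noteq> 0" using dens by linarith
      then obtain V' E' where "(V', E') \<in> copies {0..<h} EH {0..<n} E"
        by (metis card.empty ex_in_conv surj_pair)
      then obtain f where f: "V' \<subseteq> {0..<n}" "E' \<subseteq> E" "bij_betw f {0..<h} V'" "E' = (\<lambda>e. f ` e) ` EH"
        by (auto simp: copies_def iso_graphs_def)
      have "copies (blowup_V {0..<h} 1) (blowup_E EH 1) {0..<n} E \<noteq> {}"
      proof (rule copies_blowup_nonempty[where S = "\<lambda>i. {f i}"])
        fix i j a b assume *: "{i, j} \<in> EH" "a \<in> {f i}" "b \<in> {f j}"
        then have "f ` {i, j} \<in> E" using f(2,4) by blast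
        then show "{a, b} \<in> E" using * by simp
      next
        show "{f i} \<subseteq> {0..<n} \<and> card {f i} = 1" if "i \<in> {0..<h}" for i
          using that f(1) bij_betwE[OF f(3)] by (auto simp: subset_iff)
        show "{f i} \<inter> {f j} = {}" if "i \<in> {0..<h}" "j \<in> {0..<h}" "i \<noteq> j" for i j
          using that f(3) by (auto simp: bij_betw_def inj_on_def)
      qed (simp_all add: EH)
      then show ?thesis using True by (intro exI[of _ 1]) (simp add: X_def)
    next
      case False
      define k where "k = nat \<lceil>X\<rceil>"
      have k: "k > 0" "X \<le> real k" "real k \<le> 2 * X"
        using False unfolding k_def by linarith+
      \<comment> \<open>A factor \<open>h\<close> suffices to make the sets disjoint; the \<open>+ 1\<close> keeps \<open>K\<close> positive for \<open>h = 0\<close>.\<close>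
      define K where "K = (h + 1) * k"
      have logn: "\<alpha> * log 2 n = X * log 2 (1/\<gamma>)" using lg by (simp add: X_def)
      \<comment> \<open>Shrinking the sets costs at most a factor \<open>sqrt n\<close>, so at least
        \<open>sqrt n\<close> vertices remain; this exceeds the logarithmic bound on
        \<open>K\<close>.\<close>
      have sq: "1 / sqrt n \<le> \<gamma> ^ (2 * 8 ^ h * K)"
      proof -
        have "real (2 * 8 ^ h * K) * log 2 (1/\<gamma>) = real A * (real k * log 2 (1/\<gamma>))"
          by (simp add: A_def K_def algebra_simps)
        also have "\<dots> \<le> real A * (2 * X * log 2 (1/\<gamma>))"
          using k lg A0 by (intro mult_left_mono mult_right_mono) auto
        also have "\<dots> = log 2 n / 2"
          using logn A0 by (simp add: \<alpha>_def mult.assoc field_simps)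
        also have "\<dots> = log 2 (sqrt n)"
          using n by (simp add: log_def ln_sqrt)
        finally have "log 2 ((1/\<gamma>) ^ (2 * 8 ^ h * K)) \<le> log 2 (sqrt n)"
          using g by (simp add: log_nat_power)
        then have "(1/\<gamma>) ^ (2 * 8 ^ h * K) \<le> sqrt n"
          using g n by (subst (asm) log_le_cancel_iff) auto
        then show ?thesis using g n by (simp add: power_divide field_simps)
      qed
      have "real K \<le> sqrt n"
      proof -
        have "real K \<le> real (h + 1) * (2 * X)"
          unfolding K_def of_nat_mult using k by (intro mult_left_mono) auto
        also have "\<dots> \<le> real A * X"
          using of_nat_mono[OF A, where 'a = real] False mult_right_mono[of "real (2 * (h + 1))" "real A" X]
          by (simp add: mult_ac)
        also have "\<dots> \<le> real A * (X * log 2 (1/\<gamma>))"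
          using False lg A0 by (intro mult_left_mono) auto
        also have "\<dots> = log 2 n / 4"
          using A0 by (simp add: \<alpha>_def flip: logn)
        also have "\<dots> \<le> sqrt n"
          using log2_le_sqrt[of n] n by simp
        finally show ?thesis .
      qed
      also have "sqrt n = 1 / sqrt n * n"
        using n by (simp add: real_div_sqrt field_simps)
      also have "\<dots> \<le> \<gamma> ^ (2 * 8 ^ h * K) * n"
        using sq by (intro mult_right_mono) auto
      finally have size: "real K \<le> \<gamma> ^ (2 * 8 ^ h * K) * n" .
      have "\<exists>S. \<forall>i\<in>{0..<h}. S i \<subseteq> {0..<n} \<and> card (S i) = K \<and>
          (\<forall>j\<in>{0..<h}. {i, j} \<in> EH \<longrightarrow> (\<forall>a\<in>S i. \<forall>b\<in>S j. {a, b} \<in> E))"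
      proof (rule complete_sets_of_many_homs[where \<gamma> = \<gamma>])
        show "\<not> {i, l} \<in> EH" if "{i, j} \<in> EH" "{j, l} \<in> EH" for i j l
          using assms(2) that unfolding triangle_free_def by blast
        show "\<gamma> * (\<Prod>i = 0..<h. real (card {0..<n})) \<le>
            card (homs (\<lambda>i j. {i, j} \<in> EH) (\<lambda>a b. {a, b} \<in> E) {0..<h} (\<lambda>_. {0..<n}))"
          using dens card_copies_le_card_homs[of "{0..<h}" "{0..<n}" EH E, OF _ _ EH] by simp
      qed (use g k(1) size in \<open>auto simp: K_def insert_commute\<close>)
      then obtain S where S: "\<And>i. i < h \<Longrightarrow> S i \<subseteq> {0..<n}" "\<And>i. i < h \<Longrightarrow> card (S i) = K"
        "\<And>i j a b. i < h \<Longrightarrow> j < h \<Longrightarrow> {i, j} \<in> EH \<Longrightarrow> a \<in> S i \<Longrightarrow> b \<in> S j \<Longrightarrow> {a, b} \<in> E"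
        by (metis atLeastLessThan_iff zero_le)
      obtain T where T: "\<forall>i\<in>{0..<h}. T i \<subseteq> S i \<and> card (T i) = k"
        "\<forall>i\<in>{0..<h}. \<forall>j\<in>{0..<h}. i \<noteq> j \<longrightarrow> T i \<inter> T j = {}"
        using disjoint_subsets_of_large_sets[of "{0..<h}" k S] S(2) by (auto simp: K_def)
      have "copies (blowup_V {0..<h} k) (blowup_E EH k) {0..<n} E \<noteq> {}"
      proof (rule copies_blowup_nonempty[where S = T])
        fix i j a b assume *: "{i, j} \<in> EH" "a \<in> T i" "b \<in> T j"
        then have "i < h" "j < h" using EH[of "{i, j}"] by auto
        then show "{a, b} \<in> E" using S(3)[of i j a b] T(1) * by fastforce
      next
        show "T i \<subseteq> {0..<n} \<and> card (T i) = k" if "i \<in> {0..<h}" for i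
          using that T(1) S(1)[of i] by (auto simp: subset_iff)
        show "T i \<inter> T j = {}" if "i \<in> {0..<h}" "j \<in> {0..<h}" "i \<noteq> j" for i j
          using that T(2) by blast
      qed (use k EH in simp_all)
      then show ?thesis using k by (auto simp: X_def)
    qed
  qed
  then show ?thesis using \<alpha> by blast
qed

end
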